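(* Let $U\subseteq\mathbb{C}^{n\times n}$ and $V\subseteq\mathbb{C}^{k\times k}$ be linear subspaces and $U\circledast V\subseteq\mathbb{C}^{nk\times nk}$ the span of all Kronecker products $A\circledast B$ with $A\in U$, $B\in V$. Let $\mu_U,\mu_V,\mu_{U\circledast V}$ be the structure tensors of the matrix-vector products $U\times\mathbb{C}^n\to\mathbb{C}^n$, $V\times\mathbb{C}^k\to\mathbb{C}^k$, $(U\circledast V)\times\mathbb{C}^{nk}\to\mathbb{C}^{nk}$. Suppose $\operatorname{rank}(\mu_U)=\dim U$, $\operatorname{rank}(\mu_V)=\dim V$, and that the images of $U\otimes\mathbb{C}^n\to\mathbb{C}^n$ and $V\otimes\mathbb{C}^k\to\mathbb{C}^k$ (induced by the matrix-vector products) are all of $\mathbb{C}^n$ and $\mathbb{C}^k$ respectively. Then $\operatorname{rank}(\mu_{U\circledast V})=\operatorname{rank}(\mu_U)\operatorname{rank}(\mu_V)$.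
   Context: $\circledast$ denotes the Kronecker product of matrices. Structure tensor of a bilinear map $\beta:U\times V\to W$: the unique $\mu_\beta\in U^*\otimes V^*\otimes W$ with $\beta(u,v)=\mu_\beta(u,v,\cdot)$. Rank: least number of decomposable tensors summing to the tensor. *)

theory Defs
  imports "HOL-Analysis.Analysis"
begin

text \<open>Complex matrices of size n x n are represented as vectors indexed by
  'n x 'n (so that the complex vector space structure (*s) of HOL-Analysis
  applies); entry (i,j) is A $ (i,j).\<close>

definition mat_vec :: "complex ^ ('n::finite \<times> 'n) \<Rightarrow> complex ^ 'n \<Rightarrow> complex ^ 'n" where
  "mat_vec A x = (\<chi> i. \<Sum>j\<in>UNIV. A $ (i, j) * x $ j)"

text \<open>Kronecker product: rows and columns of the result are indexed by 'n x 'k,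
  entry ((i,j),(i',j')) is A(i,i') * B(j,j').\<close>
definition kron :: "complex ^ ('n::finite \<times> 'n) \<Rightarrow> complex ^ ('k::finite \<times> 'k)
                    \<Rightarrow> complex ^ (('n \<times> 'k) \<times> ('n \<times> 'k))" where
  "kron A B = (\<chi> p. A $ (fst (fst p), fst (snd p)) * B $ (snd (fst p), snd (snd p)))"

definition kron_space :: "(complex ^ ('n::finite \<times> 'n)) set \<Rightarrow> (complex ^ ('k::finite \<times> 'k)) set
                          \<Rightarrow> (complex ^ (('n \<times> 'k) \<times> ('n \<times> 'k))) set" where
  "kron_space U V = vec.span {kron A B | A B. A \<in> U \<and> B \<in> V}"

text \<open>Rank of the structure tensor of a bilinear map beta : U x W -> Z, i.e. the least
  number of decomposable tensors f (x) g (x) z (f in U*, g in W*, z in Z) summing to it;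
  the decomposable tensor f (x) g (x) z corresponds to the map (u,w) |-> f u * g w *s z.
  Linear functionals on U are represented by (restrictions of) linear functionals on the
  ambient space, which is no loss since every linear functional on U extends.\<close>
definition tensor_rank :: "(complex ^ 'a::finite) set \<Rightarrow> (complex ^ 'a \<Rightarrow> complex ^ 'b::finite \<Rightarrow> complex ^ 'c::finite) \<Rightarrow> nat" where
  "tensor_rank U \<beta> = (LEAST r. \<exists>(f :: nat \<Rightarrow> complex ^ 'a \<Rightarrow> complex) (g :: nat \<Rightarrow> complex ^ 'b \<Rightarrow> complex)
       (z :: nat \<Rightarrow> complex ^ 'c).
       (\<forall>i<r. Vector_Spaces.linear (*s) (*) (f i) \<and> Vector_Spaces.linear (*s) (*) (g i)) \<and>
       (\<forall>u\<in>U. \<forall>w. \<beta> u w = (\<Sum>i<r. (f i u * g i w) *s z i)))"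

end

theory Submission imports Defs begin

text \<open>A decomposition of \<open>\<mu>\<^sub>U\<close> into r decomposable tensors \<open>f\<^sub>i \<otimes> g\<^sub>i \<otimes> z\<^sub>i\<close> writes every
  \<open>A \<in> U\<close> as \<open>\<Sum> f\<^sub>i(A) z\<^sub>i g\<^sub>i\<^sup>T\<close>, so U lies in the span of r matrices of rank at most one; conversely
  a basis of U consisting of such matrices yields a decomposition of length \<open>dim U\<close>. Hence
  \<open>rank \<mu>\<^sub>U \<ge> dim U\<close> always, with equality iff U has a basis of rank-one matrices. Kronecker
  products of rank-one matrices are rank one, and Kronecker products of two bases form a basis of
  \<open>U \<circledast> V\<close>, so \<open>U \<circledast> V\<close> has a rank-one basis of size \<open>dim U \<cdot> dim V\<close>.\<close>

definition outer :: "complex ^ 'm \<Rightarrow> complex ^ ('m::finite) \<Rightarrow> complex ^ ('m \<times> 'm)" where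
  "outer a b = (\<chi> p. a $ fst p * b $ snd p)"

definition decomposable :: "complex ^ ('m::finite \<times> 'm) \<Rightarrow> bool" where
  "decomposable M \<longleftrightarrow> (\<exists>a b. M = outer a b)"

definition has_decomposition ::
  "(complex ^ 'a::finite) set \<Rightarrow> (complex ^ 'a \<Rightarrow> complex ^ 'b::finite \<Rightarrow> complex ^ 'c::finite) \<Rightarrow> nat \<Rightarrow> bool"
where
  "has_decomposition U \<beta> r \<longleftrightarrow> (\<exists>(f :: nat \<Rightarrow> complex ^ 'a \<Rightarrow> complex) (g :: nat \<Rightarrow> complex ^ 'b \<Rightarrow> complex)
       (z :: nat \<Rightarrow> complex ^ 'c).
       (\<forall>i<r. Vector_Spaces.linear (*s) (*) (f i) \<and> Vector_Spaces.linear (*s) (*) (g i)) \<and>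
       (\<forall>u\<in>U. \<forall>w. \<beta> u w = (\<Sum>i<r. (f i u * g i w) *s z i)))"

lemma tensor_rank_eq_Least: "tensor_rank U \<beta> = (LEAST r. has_decomposition U \<beta> r)"
  unfolding tensor_rank_def has_decomposition_def ..

subsection \<open>Linear functionals and matrix-vector products\<close>

lemma linear_functionalI:
  assumes "\<And>x y. f (x + y) = f x + f y" and "\<And>c x. f (c *s x) = c * f x"
  shows "Vector_Spaces.linear (*s) (*) (f :: complex ^ 'a::finite \<Rightarrow> complex)"
  using assms vec.vector_space_axioms vector_space_over_itself.vector_space_axioms
  by (simp add: Vector_Spaces.linear_iff)

lemma linear_functional_expansion:
  assumes "Vector_Spaces.linear (*s) (*) (g :: complex ^ 'a::finite \<Rightarrow> complex)"
  shows "g w = (\<Sum>j\<in>UNIV. g (axis j 1) * w $ j)"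
proof -
  interpret Vector_Spaces.linear "(*s)" "(*)" g by fact
  have "g w = g (\<Sum>j\<in>UNIV. w $ j *s axis j 1)" by (simp add: basis_expansion)
  also have "\<dots> = (\<Sum>j\<in>UNIV. g (axis j 1) * w $ j)" by (simp add: sum scale mult.commute)
  finally show ?thesis .
qed

lemma mat_vec_add: "mat_vec (A + B) w = mat_vec A w + mat_vec B w"
  by (simp add: vec_eq_iff mat_vec_def distrib_right sum.distrib)

lemma mat_vec_scale: "mat_vec (c *s A) w = c *s mat_vec A w"
  by (simp add: vec_eq_iff mat_vec_def sum_distrib_left mult_ac)

lemma mat_vec_zero: "mat_vec 0 w = 0"
  by (simp add: vec_eq_iff mat_vec_def)

lemma mat_vec_sum: "mat_vec (sum F S) w = (\<Sum>x\<in>S. mat_vec (F x) w)"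
  by (induct S rule: infinite_finite_induct) (simp_all add: mat_vec_add mat_vec_zero)

lemma mat_vec_outer: "mat_vec (outer a b) w = (\<Sum>j\<in>UNIV. b $ j * w $ j) *s a"
  by (simp add: vec_eq_iff mat_vec_def outer_def sum_distrib_left mult_ac)

lemma mat_vec_ext:
  assumes "\<And>w. mat_vec A w = mat_vec B w"
  shows "A = B"
proof (subst vec_eq_iff, intro allI)
  fix p :: "'a \<times> 'a"
  have "mat_vec A (axis (snd p) 1) $ fst p = mat_vec B (axis (snd p) 1) $ fst p"
    using assms by simp
  then show "A $ p = B $ p"
    by (simp add: mat_vec_def axis_def prod.case_eq_if if_distrib[of "(*) _"] cong: if_cong)
qed

lemma decomposable_axis: "decomposable (axis p 1 :: complex ^ ('m::finite \<times> 'm))"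
  unfolding decomposable_def
  by (rule exI[of _ "axis (fst p) 1"], rule exI[of _ "axis (snd p) 1"])
    (auto simp: vec_eq_iff outer_def axis_def prod_eq_iff)

subsection \<open>Tensor rank of matrix-vector multiplication\<close>

lemma has_decomposition_imp_span_decomposable:
  assumes "has_decomposition U mat_vec r"
  obtains M where "U \<subseteq> vec.span (M ` {..<r})" and "\<And>i. decomposable (M i)"
proof -
  obtain f g z where lin: "\<forall>i<r. Vector_Spaces.linear (*s) (*) (f i) \<and> Vector_Spaces.linear (*s) (*) (g i)"
    and dec: "\<forall>u\<in>U. \<forall>w. mat_vec u w = (\<Sum>i<r. (f i u * g i w) *s z i)"
    using assms unfolding has_decomposition_def by blast
  define M where "M i = outer (z i) (\<chi> j. g i (axis j 1))" for i
  have "A = (\<Sum>i<r. f i A *s M i)" if A: "A \<in> U" for A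
  proof (rule mat_vec_ext)
    fix w
    have "mat_vec (\<Sum>i<r. f i A *s M i) w = (\<Sum>i<r. f i A *s mat_vec (M i) w)"
      by (simp add: mat_vec_sum mat_vec_scale)
    also have "\<dots> = (\<Sum>i<r. (f i A * g i w) *s z i)"
    proof (rule sum.cong)
      fix i assume "i \<in> {..<r}"
      then have "g i w = (\<Sum>j\<in>UNIV. g i (axis j 1) * w $ j)"
        using lin linear_functional_expansion by blast
      then show "f i A *s mat_vec (M i) w = (f i A * g i w) *s z i"
        by (simp add: M_def mat_vec_outer)
    qed simp
    finally show "mat_vec A w = mat_vec (\<Sum>i<r. f i A *s M i) w"
      using dec A by simp
  qed
  moreover have "(\<Sum>i<r. f i A *s M i) \<in> vec.span (M ` {..<r})" for A
    by (intro vec.span_sum vec.span_scale vec.span_base) auto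
  ultimately have "U \<subseteq> vec.span (M ` {..<r})"
    by (metis subsetI)
  moreover have "decomposable (M i)" for i
    unfolding M_def decomposable_def by blast
  ultimately show thesis by (rule that)
qed

lemma has_decomposition_of_decomposable_basis:
  fixes K :: "(complex ^ ('m::finite \<times> 'm)) set"
  assumes ind: "vec.independent K" and dec: "\<forall>M\<in>K. decomposable M" and U: "U \<subseteq> vec.span K"
  shows "has_decomposition U mat_vec (card K)"
proof -
  have fin: "finite K" using ind by (rule vec.finiteI_independent)
  obtain h where h: "bij_betw h {..<card K} K"
    using ex_bij_betw_nat_finite[OF fin] by (auto simp: atLeast0LessThan)
  obtain a b where ab: "\<forall>M\<in>K. M = outer (a M) (b M)"
    using dec unfolding decomposable_def by metis
  \<comment> \<open>Coordinates with respect to K are taken in a basis of the whole space extending K,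
      so that they are linear functionals on the ambient space, as \<open>tensor_rank\<close> demands.\<close>
  define E where "E = vec.extend_basis K"
  have indE: "vec.independent E" and spE: "vec.span E = UNIV" and KE: "K \<subseteq> E"
    using ind by (auto simp: E_def vec.independent_extend_basis vec.extend_basis_superset)
  define G where "G M w = (\<Sum>j\<in>UNIV. b M $ j * w $ j)" for M w
  have linG: "Vector_Spaces.linear (*s) (*) (G M)" for M
    by (rule linear_functionalI) (simp_all add: G_def distrib_left sum.distrib sum_distrib_left mult_ac)
  have "mat_vec A w = (\<Sum>i<card K. (vec.representation E A (h i) * G (h i) w) *s a (h i))"
    if A: "A \<in> U" for A w
  proof -
    have AK: "A \<in> vec.span K" using A U by auto
    have "(\<Sum>M\<in>K. vec.representation K A M *s M) = A"
      using vec.sum_representation_eq[OF ind AK fin] by simp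
    then have "mat_vec A w = mat_vec (\<Sum>M\<in>K. vec.representation K A M *s M) w"
      by simp
    also have "\<dots> = (\<Sum>M\<in>K. vec.representation K A M *s mat_vec M w)"
      by (simp add: mat_vec_sum mat_vec_scale)
    also have "\<dots> = (\<Sum>M\<in>K. (vec.representation E A M * G M w) *s a M)"
    proof (rule sum.cong)
      fix M assume "M \<in> K"
      then have "mat_vec M w = G M w *s a M"
        using ab mat_vec_outer unfolding G_def by metis
      then show "vec.representation K A M *s mat_vec M w = (vec.representation E A M * G M w) *s a M"
        using vec.representation_extend[OF indE AK KE] by simp
    qed simp
    also have "\<dots> = (\<Sum>i<card K. (vec.representation E A (h i) * G (h i) w) *s a (h i))"
      using sum.reindex_bij_betw[OF h, of "\<lambda>M. (vec.representation E A M * G M w) *s a M"] by simp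
    finally show ?thesis .
  qed
  then show ?thesis
    unfolding has_decomposition_def
    using linG vec.linear_representation[OF indE spE]
    by (intro exI[of _ "\<lambda>i A. vec.representation E A (h i)"] exI[of _ "\<lambda>i. G (h i)"]
        exI[of _ "\<lambda>i. a (h i)"]) blast
qed

lemma tensor_rank_le_card:
  fixes K :: "(complex ^ ('m::finite \<times> 'm)) set"
  assumes "vec.independent K" and "\<forall>M\<in>K. decomposable M" and "U \<subseteq> vec.span K"
  shows "tensor_rank U mat_vec \<le> card K"
  unfolding tensor_rank_eq_Least
  using has_decomposition_of_decomposable_basis[OF assms] by (rule Least_le)

lemma has_decomposition_tensor_rank:
  "has_decomposition (U :: (complex ^ ('m::finite \<times> 'm)) set) mat_vec (tensor_rank U mat_vec)"
proof -
  have "\<forall>M\<in>cart_basis. decomposable (M :: complex ^ ('m \<times> 'm))"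
    by (auto simp: cart_basis_def decomposable_axis)
  then have "has_decomposition U mat_vec (card (cart_basis :: (complex ^ ('m \<times> 'm)) set))"
    by (intro has_decomposition_of_decomposable_basis) (auto simp: independent_cart_basis)
  then show ?thesis
    unfolding tensor_rank_eq_Least by (rule LeastI)
qed

lemma dim_le_tensor_rank:
  "vec.dim (U :: (complex ^ ('m::finite \<times> 'm)) set) \<le> tensor_rank U mat_vec"
proof -
  obtain M where "U \<subseteq> vec.span (M ` {..<tensor_rank U mat_vec})"
    using has_decomposition_imp_span_decomposable[OF has_decomposition_tensor_rank] .
  then have "vec.dim U \<le> card (M ` {..<tensor_rank U mat_vec})"
    by (simp add: vec.dim_le_card)
  also have "\<dots> \<le> tensor_rank U mat_vec"
    using card_image_le[of "{..<tensor_rank U mat_vec}" M] by simp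
  finally show ?thesis .
qed

lemma decomposable_basis_if_tensor_rank_eq_dim:
  fixes U :: "(complex ^ ('m::finite \<times> 'm)) set"
  assumes sub: "vec.subspace U" and rank: "tensor_rank U mat_vec = vec.dim U"
  obtains S where "vec.independent S" and "vec.span S = U" and "card S = vec.dim U"
    and "\<forall>M\<in>S. decomposable M"
proof -
  obtain M where M: "U \<subseteq> vec.span (M ` {..<vec.dim U})" "\<And>i. decomposable (M i)"
    using has_decomposition_imp_span_decomposable has_decomposition_tensor_rank[of U] rank by metis
  define S where "S = M ` {..<vec.dim U}"
  have fin: "finite S" unfolding S_def by simp
  have le: "card S \<le> vec.dim U" unfolding S_def using card_image_le by fastforce
  have ge: "vec.dim U \<le> card S" using vec.dim_le_card[OF M(1)[folded S_def] fin] .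
  have "vec.dim (vec.span S) \<le> vec.dim U"
    using vec.dim_le_card[OF vec.span_superset fin] le by simp
  then have "vec.span U = vec.span S"
    using vec.dim_eq_span[of U "vec.span S"] M(1) by (simp add: S_def vec.span_span)
  then have span: "vec.span S = U"
    using sub by (metis vec.span_eq_iff)
  have "vec.independent S"
    using vec.card_eq_dim[of S "vec.span S"] fin le ge span vec.span_superset by auto
  with span le ge M(2) show thesis
    by (intro that) (auto simp: S_def)
qed

subsection \<open>Kronecker products\<close>

lemma kron_outer:
  "kron (outer a b) (outer c d) = outer (\<chi> p. a $ fst p * c $ snd p) (\<chi> p. b $ fst p * d $ snd p)"
  by (simp add: vec_eq_iff kron_def outer_def mult_ac)

lemma decomposable_kron: "decomposable A \<Longrightarrow> decomposable B \<Longrightarrow> decomposable (kron A B)"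
  unfolding decomposable_def using kron_outer by blast

lemma kron_add_left: "kron (A + A') B = kron A B + kron A' B"
  by (simp add: vec_eq_iff kron_def distrib_right)
lemma kron_scale_left: "kron (c *s A) B = c *s kron A B"
  by (simp add: vec_eq_iff kron_def mult_ac)
lemma kron_zero_left: "kron 0 B = 0"
  by (simp add: vec_eq_iff kron_def)
lemma kron_add_right: "kron A (B + B') = kron A B + kron A B'"
  by (simp add: vec_eq_iff kron_def distrib_left)
lemma kron_scale_right: "kron A (c *s B) = c *s kron A B"
  by (simp add: vec_eq_iff kron_def mult_ac)
lemma kron_zero_right: "kron A 0 = 0"
  by (simp add: vec_eq_iff kron_def)

lemma kron_independent_explicit:
  fixes SU :: "(complex ^ ('n::finite \<times> 'n)) set" and SV :: "(complex ^ ('k::finite \<times> 'k)) set"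
  assumes iU: "vec.independent SU" and iV: "vec.independent SV"
    and z: "(\<Sum>p\<in>SU \<times> SV. c p *s case_prod kron p) = 0"
  shows "\<forall>p\<in>SU \<times> SV. c p = 0"
proof -
  \<comment> \<open>Each entry of the combination is a vanishing combination of SU, whose coefficients
      are in turn combinations of SV.\<close>
  have entry: "(\<Sum>a\<in>SU. \<Sum>b\<in>SV. c (a, b) * (a $ (i, i') * b $ (j, j'))) = 0" for i i' j j'
  proof -
    have "(\<Sum>p\<in>SU \<times> SV. c p *s case_prod kron p) $ ((i, j), (i', j')) = 0" using z by simp
    then show ?thesis by (simp add: sum_component kron_def sum.cartesian_product split_def)
  qed
  have "(\<Sum>b\<in>SV. c (a, b) * b $ (j, j')) = 0" if "a \<in> SU" for a j j'
  proof -
    define d where "d a = (\<Sum>b\<in>SV. c (a, b) * b $ (j, j'))" for a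
    have "(\<Sum>a\<in>SU. d a *s a) = 0"
      using entry by (simp add: d_def vec_eq_iff sum_component sum_distrib_left sum_distrib_right mult_ac)
    then have "d a = 0"
      using iU that unfolding vec.independent_explicit by blast
    then show ?thesis by (simp add: d_def)
  qed
  then have "(\<Sum>b\<in>SV. c (a, b) *s b) = 0" if "a \<in> SU" for a
    using that by (simp add: vec_eq_iff sum_component)
  then have "c (a, b) = 0" if "a \<in> SU" and "b \<in> SV" for a b
    using iV[unfolded vec.independent_explicit, THEN conjunct2, rule_format, of "\<lambda>b. c (a, b)"] that
    by blast
  then show ?thesis by blast
qed

lemma inj_on_kron:
  fixes SU :: "(complex ^ ('n::finite \<times> 'n)) set" and SV :: "(complex ^ ('k::finite \<times> 'k)) set"
  assumes "vec.independent SU" and "vec.independent SV"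
  shows "inj_on (case_prod kron) (SU \<times> SV)"
proof (rule inj_onI, rule ccontr)
  fix p q assume p: "p \<in> SU \<times> SV" and q: "q \<in> SU \<times> SV"
    and eq: "case_prod kron p = case_prod kron q" and "p \<noteq> q"
  define c where "c r = (if r = p then 1 else if r = q then -1 else (0::complex))" for r
  have "(\<Sum>r\<in>SU \<times> SV. c r *s case_prod kron r)
      = (\<Sum>r\<in>SU \<times> SV. (if r = p then case_prod kron r else 0) + (if r = q then - case_prod kron r else 0))"
    using \<open>p \<noteq> q\<close> by (intro sum.cong) (auto simp: c_def)
  also have "\<dots> = 0"
    using p q eq assms by (simp add: sum.distrib vec.finiteI_independent)
  finally have "c p = 0"
    using kron_independent_explicit[OF assms] p by blast
  then show False by (simp add: c_def)
qed

lemma independent_kron_image: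
  fixes SU :: "(complex ^ ('n::finite \<times> 'n)) set" and SV :: "(complex ^ ('k::finite \<times> 'k)) set"
  assumes "vec.independent SU" and "vec.independent SV"
  shows "vec.independent (case_prod kron ` (SU \<times> SV))"
  unfolding vec.independent_explicit
proof (intro conjI allI impI ballI)
  show "finite (case_prod kron ` (SU \<times> SV))" using assms by (simp add: vec.finiteI_independent)
  fix u v assume z: "(\<Sum>v\<in>case_prod kron ` (SU \<times> SV). u v *s v) = 0"
    and v: "v \<in> case_prod kron ` (SU \<times> SV)"
  have "(\<Sum>r\<in>SU \<times> SV. u (case_prod kron r) *s case_prod kron r) = 0"
    using z sum.reindex[OF inj_on_kron[OF assms], of "\<lambda>v. u v *s v"] by simp
  then have "\<forall>r\<in>SU \<times> SV. u (case_prod kron r) = 0"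
    using kron_independent_explicit[OF assms, of "\<lambda>r. u (case_prod kron r)"] by blast
  with v show "u v = 0" by auto
qed

lemma kron_space_span:
  fixes SU :: "(complex ^ ('n::finite \<times> 'n)) set" and SV :: "(complex ^ ('k::finite \<times> 'k)) set"
  shows "kron_space (vec.span SU) (vec.span SV) = vec.span (case_prod kron ` (SU \<times> SV))"
proof -
  let ?K = "case_prod kron ` (SU \<times> SV)"
  have generator_left: "kron a B \<in> vec.span ?K" if "a \<in> SU" and "B \<in> vec.span SV" for a B
    using \<open>B \<in> vec.span SV\<close>
  proof (induct rule: vec.span_induct)
    case base
    show ?case by (auto simp: vec.subspace_def kron_zero_right kron_add_right kron_scale_right
        vec.span_zero vec.span_add vec.span_scale)
  next
    case (step b)
    then show ?case using \<open>a \<in> SU\<close> by (intro vec.span_base) (auto intro: image_eqI[of _ _ "(a, b)"])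
  qed
  have "\<forall>B\<in>vec.span SV. kron A B \<in> vec.span ?K" if "A \<in> vec.span SU" for A
    using that
  proof (induct rule: vec.span_induct)
    case base
    show ?case by (auto simp: vec.subspace_def kron_zero_left kron_add_left kron_scale_left
        vec.span_zero vec.span_add vec.span_scale)
  next
    case (step a)
    then show ?case using generator_left by blast
  qed
  then have products_in_span: "{kron A B |A B. A \<in> vec.span SU \<and> B \<in> vec.span SV} \<subseteq> vec.span ?K"
    by blast
  have basis_products: "?K \<subseteq> {kron A B |A B. A \<in> vec.span SU \<and> B \<in> vec.span SV}"
  proof
    fix x assume "x \<in> ?K"
    then obtain a b where "a \<in> SU" "b \<in> SV" "x = kron a b" by auto
    then show "x \<in> {kron A B |A B. A \<in> vec.span SU \<and> B \<in> vec.span SV}"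
      using vec.span_base[of a SU] vec.span_base[of b SV] by blast
  qed
  show ?thesis
    unfolding kron_space_def
    using vec.span_mono[OF products_in_span] vec.span_mono[OF basis_products] by (simp add: vec.span_span)
qed

theorem mainTheorem12:
  fixes U :: "(complex ^ ('n::finite \<times> 'n)) set" and V :: "(complex ^ ('k::finite \<times> 'k)) set"
  assumes "vec.subspace U" and "vec.subspace V"
    and "tensor_rank U mat_vec = vec.dim U"
    and "tensor_rank V mat_vec = vec.dim V"
    and "vec.span {mat_vec A x | A x. A \<in> U} = UNIV"
    and "vec.span {mat_vec B y | B y. B \<in> V} = UNIV"
  shows "tensor_rank (kron_space U V) mat_vec = tensor_rank U mat_vec * tensor_rank V mat_vec"
proof -
  obtain SU where SU: "vec.independent SU" "vec.span SU = U" "card SU = vec.dim U"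
      "\<forall>M\<in>SU. decomposable M"
    using decomposable_basis_if_tensor_rank_eq_dim[OF assms(1,3)] by blast
  obtain SV where SV: "vec.independent SV" "vec.span SV = V" "card SV = vec.dim V"
      "\<forall>M\<in>SV. decomposable M"
    using decomposable_basis_if_tensor_rank_eq_dim[OF assms(2,4)] by blast
  define K where "K = case_prod kron ` (SU \<times> SV)"
  have indK: "vec.independent K"
    using independent_kron_image[OF SU(1) SV(1)] by (simp add: K_def)
  have cardK: "card K = vec.dim U * vec.dim V"
    using card_image[OF inj_on_kron[OF SU(1) SV(1)]] SU(3) SV(3)
    by (simp add: K_def card_cartesian_product)
  have span: "kron_space U V = vec.span K"
    using kron_space_span[of SU SV] SU(2) SV(2) by (simp add: K_def)
  have decK: "\<forall>M\<in>K. decomposable M"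
    using SU(4) SV(4) by (auto simp: K_def decomposable_kron)
  have "tensor_rank (kron_space U V) mat_vec \<le> card K"
    using tensor_rank_le_card[OF indK decK] span by simp
  moreover have "card K \<le> tensor_rank (kron_space U V) mat_vec"
    using dim_le_tensor_rank[of "kron_space U V"] span indK by (simp add: vec.dim_eq_card_independent)
  ultimately show ?thesis
    using cardK assms(3,4) by simp
qed

end
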